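(* For the uniform case of decremental sets, every randomized online algorithm has competitive ratio at least $\mathrm{e}/(\mathrm{e}-1)$ (against an oblivious adversary).
   Context: Dynamic set problem: items with weights; time proceeds in steps; before each step items may be inserted into or deleted from a dynamic set $\mathcal{S}$; an item is active if inserted and not yet deleted; at each step an algorithm may collect at most one active item it has not collected before (such items are pending); the gain is the total weight collected. Online algorithms decide knowing only past insertions/deletions. Uniform case: all items have weight $1$. Decremental: all items are inserted before the first step, afterwards only deletions occur. A randomized online algorithm is $R$-competitive against an oblivious adversary if for every instance $I$ (fixed in advance, independently of the algorithm's random choices) its expected gain is at least $\mathrm{OPT}(I)/R$, where $\mathrm{OPT}(I)$ is the maximum achievable gain on $I$; the competitive ratio is the infimum of such $R$. *)

theory Defs
  imports "HOL-Probability.Probability"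
begin

type_synonym item = nat

datatype update = Insert item real | Delete item

text \<open>
  An input with \<open>n\<close> steps is a list of \<open>n\<close> batches of updates;
  batch \<open>t\<close> takes place immediately before step \<open>t\<close>
  (steps are numbered from \<open>0\<close>).
\<close>

type_synonym input = "update list list"

fun apply_update :: "update \<Rightarrow> (item \<rightharpoonup> real) \<Rightarrow> (item \<rightharpoonup> real)" where
  "apply_update (Insert x w) S = S(x \<mapsto> w)"
| "apply_update (Delete x) S = S(x := None)"

text \<open>The set of active items, represented as the map from each of them to its weight.\<close>

definition contents :: "update list \<Rightarrow> (item \<rightharpoonup> real)" where
  "contents us = fold apply_update us Map.empty"

definition history :: "input \<Rightarrow> nat \<Rightarrow> input" where
  "history I t = take (Suc t) I"

definition active_at :: "input \<Rightarrow> nat \<Rightarrow> (item \<rightharpoonup> real)" where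
  "active_at I t = contents (concat (history I t))"

text \<open>An item is inserted at most once, and only active items are deleted.\<close>

definition well_formed :: "input \<Rightarrow> bool" where
  "well_formed I \<longleftrightarrow>
     (let us = concat I in
      \<forall>i < length us.
        (case us ! i of
           Insert x w \<Rightarrow> 0 \<le> w \<and> (\<forall>j < i. \<forall>v. us ! j \<noteq> Insert x v)
         | Delete x \<Rightarrow> x \<in> dom (contents (take i us))))"

definition uniform :: "input \<Rightarrow> bool" where
  "uniform I \<longleftrightarrow> (\<forall>x w. Insert x w \<in> set (concat I) \<longrightarrow> w = 1)"

definition decremental :: "input \<Rightarrow> bool" where
  "decremental I \<longleftrightarrow> (\<forall>us \<in> set (tl I). \<forall>x w. Insert x w \<notin> set us)"

definition uniform_decremental_inputs :: "input set" where
  "uniform_decremental_inputs = {I. well_formed I \<and> uniform I \<and> decremental I}"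

text \<open>
  A schedule lists the item collected in each step, with \<open>None\<close> for a step in which
  nothing is collected. A collected item stays active until it is deleted.
\<close>

type_synonym schedule = "item option list"

definition pending :: "input \<Rightarrow> schedule \<Rightarrow> nat \<Rightarrow> item set" where
  "pending I s t = dom (active_at I t) - {x. \<exists>j < t. s ! j = Some x}"

definition feasible :: "input \<Rightarrow> schedule \<Rightarrow> bool" where
  "feasible I s \<longleftrightarrow>
     length s = length I \<and> (\<forall>t < length I. \<forall>x. s ! t = Some x \<longrightarrow> x \<in> pending I s t)"

definition gain :: "input \<Rightarrow> schedule \<Rightarrow> real" where
  "gain I s =
     (\<Sum>t < length I. case s ! t of None \<Rightarrow> 0 | Some x \<Rightarrow> the (active_at I t x))"

definition OPT :: "input \<Rightarrow> real" where
  "OPT I = Max (gain I ` {s. feasible I s})"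

text \<open>The maximum in the definition of \<open>OPT\<close> ranges over a finite nonempty set.\<close>

lemma finite_dom_contents: "finite (dom (contents us))"
proof -
  have "finite (dom S) \<Longrightarrow> finite (dom (fold apply_update us S))" for S
  proof (induction us arbitrary: S)
    case (Cons u us)
    have "finite (dom (apply_update u S))"
      using Cons.prems by (cases u) simp_all
    then show ?case using Cons.IH by simp
  qed simp
  then show ?thesis by (simp add: contents_def)
qed

lemma finite_feasible: "finite {s. feasible I s}"
proof -
  let ?B = "insert None (Some ` (\<Union>t < length I. dom (active_at I t)))"
  have "finite ?B" by (auto simp: active_at_def finite_dom_contents)
  moreover have "{s. feasible I s} \<subseteq> {s. set s \<subseteq> ?B \<and> length s = length I}"
  proof (intro subsetI CollectI conjI)
    fix s c assume s: "s \<in> {s. feasible I s}" and "c \<in> set s"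
    then obtain t where "t < length I" "c = s ! t"
      by (auto simp: in_set_conv_nth feasible_def)
    with s show "c \<in> ?B" by (cases c) (force simp: feasible_def pending_def)+
  qed (auto simp: feasible_def)
  ultimately show ?thesis
    by (rule finite_subset[OF _ finite_lists_length_eq, rotated])
qed

lemma feasible_replicate_None: "feasible I (replicate (length I) None)"
  by (simp add: feasible_def)

text \<open>
  A deterministic online algorithm maps the batches seen so far to its choice in the current
  step; its own earlier choices are determined by the prefixes of that list.
\<close>

type_synonym online_algorithm = "input \<Rightarrow> item option"

definition run :: "online_algorithm \<Rightarrow> input \<Rightarrow> schedule" where
  "run a I = map (\<lambda>t. a (history I t)) [0..<length I]"

text \<open>
  A randomized online algorithm for the inputs in \<open>C\<close> draws its random bits \<open>\<omega>\<close> from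
  a probability space \<open>M\<close> and then runs the deterministic online algorithm \<open>A \<omega>\<close>.
\<close>

definition randomized_online_algorithm ::
    "input set \<Rightarrow> 'w measure \<Rightarrow> ('w \<Rightarrow> online_algorithm) \<Rightarrow> bool" where
  "randomized_online_algorithm C M A \<longleftrightarrow>
     prob_space M \<and>
     (\<forall>h. (\<lambda>\<omega>. A \<omega> h) \<in> measurable M (count_space UNIV)) \<and>
     (\<forall>\<omega> \<in> space M. \<forall>I \<in> C. feasible I (run (A \<omega>) I))"

definition expected_gain :: "'w measure \<Rightarrow> ('w \<Rightarrow> online_algorithm) \<Rightarrow> input \<Rightarrow> real" where
  "expected_gain M A I = (\<integral>\<omega>. gain I (run (A \<omega>) I) \<partial>M)"

text \<open>
  The adversary is oblivious because the input \<open>I\<close> is fixed before \<open>\<omega>\<close> is drawn.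
  Positivity of \<open>R\<close> is required since \<open>x / 0 = 0\<close>.
\<close>

definition competitive ::
    "input set \<Rightarrow> 'w measure \<Rightarrow> ('w \<Rightarrow> online_algorithm) \<Rightarrow> real \<Rightarrow> bool" where
  "competitive C M A R \<longleftrightarrow> 0 < R \<and> (\<forall>I \<in> C. OPT I / R \<le> expected_gain M A I)"

text \<open>The ratio is \<open>\<infinity>\<close> if the algorithm is not \<open>R\<close>-competitive for any \<open>R\<close>.\<close>

definition competitive_ratio ::
    "input set \<Rightarrow> 'w measure \<Rightarrow> ('w \<Rightarrow> online_algorithm) \<Rightarrow> ereal" where
  "competitive_ratio C M A = Inf (ereal ` {R. competitive C M A R})"

end

theory Submission
  imports Defs "HOL-Combinatorics.Permutations"
begin

text \<open>
  By Yao's principle it is enough to find a distribution on inputs that is hard for deterministic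
  algorithms. Insert \<open>n\<close> items and delete them one by one, one after each step, in a uniformly
  random order \<open>p\<close>; collecting the items in this order shows that the optimum is \<open>n\<close>. The choice
  of an algorithm in step \<open>t\<close> depends only on \<open>p 0, \<dots>, p (t - 1)\<close>, so by symmetry it equals \<open>p j\<close>
  with probability at most \<open>1 / (n - t)\<close>, for every \<open>j \<ge> t\<close>. Bounding the probability that \<open>p j\<close>
  is ever collected by \<open>\<Sum>t\<le>j. 1 / (n - t)\<close> for \<open>j < n - k\<close> and by \<open>1\<close> for the last \<open>k\<close> items
  gives an expected gain of at most
  \<open>n - k * (\<Sum>t<n - k. 1 / (n - t)) \<le> n - k * ln ((n + 1) / (k + 1))\<close>, and \<open>k \<approx> n / e\<close> yields
  \<open>(1 - 1 / e) * n + O(1)\<close>.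
\<close>

section \<open>Deletion in a prescribed order\<close>

text \<open>Item \<open>p t\<close> is deleted just before step \<open>t + 1\<close>, so it can be
  collected exactly in the steps \<open>0, ..., t\<close>. There are only \<open>n - 1\<close>
  deletions, which leaves \<open>p (n - 1)\<close> active in the last step and gives
  \<open>n\<close> steps when \<open>n > 0\<close>.\<close>

definition deletion_input :: "nat \<Rightarrow> (nat \<Rightarrow> item) \<Rightarrow> input" where
  "deletion_input n p =
     map (\<lambda>x. Insert x 1) [0..<n] # map (\<lambda>t. [Delete (p t)]) [0..<n - 1]"

lemma length_deletion_input: "n > 0 \<Longrightarrow> length (deletion_input n p) = n"
  by (simp add: deletion_input_def)

lemma history_deletion_input:
  assumes "t < n"
  shows "history (deletion_input n p) t =
    map (\<lambda>x. Insert x 1) [0..<n] # map (\<lambda>t. [Delete (p t)]) [0..<t]"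
  using assms by (simp add: history_def deletion_input_def take_map)

text \<open>This is how the online restriction enters: in step \<open>t\<close> the values of
  \<open>p\<close> from position \<open>t\<close> on are still hidden.\<close>

lemma history_deletion_input_cong:
  assumes "t < n" "\<And>s. s < t \<Longrightarrow> p s = q s"
  shows "history (deletion_input n p) t = history (deletion_input n q) t"
  using assms by (simp add: history_deletion_input)

lemma contents_append: "contents (us @ vs) = fold apply_update vs (contents us)"
  by (simp add: contents_def)

lemma contents_inserts:
  "contents (map (\<lambda>x. Insert x 1) [0..<k]) = (\<lambda>x. if x < k then Some 1 else None)"
proof (induction k)
  case (Suc k)
  then show ?case by (auto simp: contents_append less_Suc_eq fun_eq_iff)
qed (simp add: contents_def)

lemma contents_inserts_deletes:
  "contents (map (\<lambda>x. Insert x 1) [0..<n] @ map (\<lambda>t. Delete (p t)) ts) =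
     (\<lambda>x. if x < n \<and> x \<notin> p ` set ts then Some 1 else None)"
proof (induction ts rule: rev_induct)
  case Nil
  then show ?case by (simp add: contents_inserts)
next
  case (snoc t ts)
  have "contents (map (\<lambda>x. Insert x 1) [0..<n] @ map (\<lambda>t. Delete (p t)) (ts @ [t])) =
    (contents (map (\<lambda>x. Insert x 1) [0..<n] @ map (\<lambda>t. Delete (p t)) ts))(p t := None)"
    by (simp add: contents_append)
  also have "\<dots> = (\<lambda>x. if x < n \<and> x \<notin> p ` set (ts @ [t]) then Some 1 else None)"
    unfolding snoc by (auto simp: fun_eq_iff)
  finally show ?case .
qed

lemma concat_deletion_input:
  "concat (deletion_input n p) =
     map (\<lambda>x. Insert x 1) [0..<n] @ map (\<lambda>t. Delete (p t)) [0..<n - 1]"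
  by (simp add: deletion_input_def)

lemma permutes_lessThan_iff:
  assumes "p permutes {..<n}"
  shows "p x < n \<longleftrightarrow> x < n"
  using permutes_in_image[OF assms, of x] by simp

lemma active_at_deletion_input:
  assumes p: "p permutes {..<n}" and t: "t < n"
  shows "active_at (deletion_input n p) t = (\<lambda>x. if x \<in> p ` {t..<n} then Some 1 else None)"
proof -
  have "{t..<n} = {..<n} - {0..<t}" using t by auto
  then have "p ` {t..<n} = p ` {..<n} - p ` {0..<t}"
    by (simp only: image_set_diff[OF permutes_inj[OF p]])
  also have "p ` {..<n} = {..<n}" by (rule permutes_image[OF p])
  finally have *: "x \<in> p ` {t..<n} \<longleftrightarrow> x < n \<and> x \<notin> p ` {0..<t}" for x by auto
  show ?thesis
    unfolding active_at_def history_deletion_input[OF t] *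
    using contents_inserts_deletes[of n p "[0..<t]"] by simp
qed

lemma deletion_input_uniform_decremental:
  assumes p: "p permutes {..<n}"
  shows "deletion_input n p \<in> uniform_decremental_inputs"
proof -
  let ?ins = "map (\<lambda>x. Insert x 1) [0..<n]"
  let ?us = "concat (deletion_input n p)"
  have "case ?us ! i of
          Insert x w \<Rightarrow> 0 \<le> w \<and> (\<forall>j < i. \<forall>v. ?us ! j \<noteq> Insert x v)
        | Delete x \<Rightarrow> x \<in> dom (contents (take i ?us))" if i: "i < length ?us" for i
  proof (cases "i < n")
    case True
    then show ?thesis by (simp add: concat_deletion_input nth_append)
  next
    case False
    define t where "t = i - n"
    have t: "i = n + t" "t < n - 1"
      using i False by (auto simp: t_def concat_deletion_input)
    have "?us ! i = Delete (p t)"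
      using t by (simp add: concat_deletion_input nth_append)
    moreover have "take i ?us = ?ins @ map (\<lambda>t. Delete (p t)) [0..<t]"
      using t by (simp add: concat_deletion_input take_map)
    moreover have "p t \<notin> p ` set [0..<t]"
      by (auto simp: inj_eq[OF permutes_inj[OF p]])
    moreover have "p t < n" using t by (simp add: permutes_lessThan_iff[OF p])
    ultimately show ?thesis
      by (simp add: contents_inserts_deletes dom_def)
  qed
  then have "well_formed (deletion_input n p)"
    by (simp add: well_formed_def Let_def)
  moreover have "uniform (deletion_input n p)"
    by (auto simp: uniform_def concat_deletion_input)
  moreover have "decremental (deletion_input n p)"
    by (auto simp: decremental_def deletion_input_def)
  ultimately show ?thesis by (simp add: uniform_decremental_inputs_def)
qed

section \<open>Optimum and gain on a deletion input\<close>

lemma OPT_deletion_input_ge: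
  assumes p: "p permutes {..<n}" and "n > 0"
  shows "real n \<le> OPT (deletion_input n p)"
proof -
  let ?I = "deletion_input n p"
  let ?s = "map (\<lambda>t. Some (p t)) [0..<n]"
  have len: "length ?I = n" using \<open>n > 0\<close> by (rule length_deletion_input)
  have "feasible ?I ?s"
    by (auto simp: feasible_def len pending_def active_at_deletion_input[OF p] dom_def
        inj_eq[OF permutes_inj[OF p]])
  moreover have "gain ?I ?s = real n"
    by (simp add: gain_def len active_at_deletion_input[OF p])
  ultimately show ?thesis
    unfolding OPT_def by (intro Max_ge finite_imageI finite_feasible) force
qed

text \<open>Regroups the gain by item instead of by step. The inner sum stops at \<open>j\<close>
  because \<open>p j\<close> is gone afterwards.\<close>

lemma gain_deletion_input:
  assumes p: "p permutes {..<n}" and "n > 0" and s: "feasible (deletion_input n p) s"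
  shows "gain (deletion_input n p) s = (\<Sum>j<n. \<Sum>t\<le>j. of_bool (s ! t = Some (p j)))"
proof -
  let ?I = "deletion_input n p"
  have len: "length ?I = n" using \<open>n > 0\<close> by (rule length_deletion_input)
  have step: "(case s ! t of None \<Rightarrow> 0 | Some x \<Rightarrow> the (active_at ?I t x)) =
      (\<Sum>j<n. if t \<le> j then of_bool (s ! t = Some (p j)) else (0::real))" if t: "t < n" for t
  proof (cases "s ! t")
    case (Some x)
    then have "x \<in> dom (active_at ?I t)"
      using s t by (auto simp: feasible_def pending_def len)
    then obtain i where i: "x = p i" "t \<le> i" "i < n"
      by (auto simp: active_at_deletion_input[OF p t] dom_def split: if_splits)
    \<comment> \<open>Since \<open>p\<close> is injective, only the index \<open>i\<close> of the
      collected item contributes.\<close>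
    have "(if t \<le> j then of_bool (s ! t = Some (p j)) else (0::real)) = (if i = j then 1 else 0)"
      for j using Some i by (auto simp: inj_eq[OF permutes_inj[OF p]])
    then have "(\<Sum>j<n. if t \<le> j then of_bool (s ! t = Some (p j)) else (0::real)) = 1"
      using i by simp
    then show ?thesis using Some i by (simp add: active_at_deletion_input[OF p t])
  qed (auto intro!: sum.neutral)
  have "gain ?I s = (\<Sum>t<n. \<Sum>j<n. if t \<le> j then of_bool (s ! t = Some (p j)) else 0)"
    unfolding gain_def len by (intro sum.cong refl step) simp
  also have "\<dots> = (\<Sum>j<n. \<Sum>t<n. if t \<le> j then of_bool (s ! t = Some (p j)) else 0)"
    by (rule sum.swap)
  also have "\<dots> = (\<Sum>j<n. \<Sum>t\<le>j. of_bool (s ! t = Some (p j)))"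
  proof (rule sum.cong[OF refl])
    fix j assume "j \<in> {..<n}"
    then have "{..<n} \<inter> {t. t \<le> j} = {..j}" by auto
    then show "(\<Sum>t<n. if t \<le> j then of_bool (s ! t = Some (p j)) else 0) =
        (\<Sum>t\<le>j. of_bool (s ! t = Some (p j)) :: real)"
      by (simp add: sum.If_cases)
  qed
  finally show ?thesis .
qed

text \<open>A collected item is no longer pending, so at most one summand is nonzero.\<close>

lemma sum_collected_le_1:
  assumes "feasible I s" "j < length I"
  shows "(\<Sum>t\<le>j. of_bool (s ! t = Some x)) \<le> (1::real)"
proof (cases "\<exists>t\<le>j. s ! t = Some x")
  case True
  then obtain u where u: "u \<le> j" "s ! u = Some x" by blast
  have once: "s ! v \<noteq> Some x" if "v < w" "w \<le> j" "s ! w = Some x" for v w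
  proof -
    have "x \<in> pending I s w" using assms that by (simp add: feasible_def)
    then show ?thesis using \<open>v < w\<close> by (auto simp: pending_def)
  qed
  have "s ! t = Some x \<longleftrightarrow> t = u" if "t \<le> j" for t
    using once[of t u] once[of u t] u that by (cases t u rule: linorder_cases) auto
  then have "(\<Sum>t\<le>j. of_bool (s ! t = Some x)) = (\<Sum>t\<le>j. if t = u then 1 else (0::real))"
    by (intro sum.cong) simp_all
  then show ?thesis using u by simp
next
  case False
  then have "(\<Sum>t\<le>j. of_bool (s ! t = Some x)) = (0::real)"
    by (intro sum.neutral) auto
  then show ?thesis by simp
qed

section \<open>Averaging over all orders\<close>

text \<open>Here \<open>f\<close> stands for the history and \<open>g\<close> for the algorithm's
  answer to it. Swapping two positions \<open>i, j \<ge> t\<close> of \<open>p\<close> leaves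
  \<open>f p\<close> unchanged, so the sums for all \<open>n - t\<close> positions from
  \<open>t\<close> on are equal. Together they are at most \<open>fact n\<close>, since an answer
  matches at most one position of each \<open>p\<close>.\<close>

lemma sum_permutations_hit_le:
  fixes f :: "(nat \<Rightarrow> nat) \<Rightarrow> 'b" and g :: "'b \<Rightarrow> nat option"
  assumes f: "\<And>p q. (\<And>s. s < t \<Longrightarrow> p s = q s) \<Longrightarrow> f p = f q"
    and j: "t \<le> j" "j < n"
  shows "(\<Sum>p | p permutes {..<n}. of_bool (g (f p) = Some (p j))) \<le> fact n / real (n - t)"
proof -
  let ?P = "{p. p permutes {..<n}}"
  let ?h = "\<lambda>i p. of_bool (g (f p) = Some (p i)) :: real"
  have sym: "sum (?h i) ?P = sum (?h j) ?P" if i: "t \<le> i" "i < n" for i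
  proof -
    let ?\<tau> = "Transposition.transpose i j"
    have \<tau>: "?\<tau> permutes {..<n}" using i j by (intro permutes_swap_id) auto
    have "sum (?h j) ?P = (\<Sum>p\<in>?P. ?h j (p \<circ> ?\<tau>))"
    \<comment> \<open>Composition with a transposition is an involution on the permutations.\<close>
    proof (rule sum.reindex_bij_witness[of _ "\<lambda>p. p \<circ> ?\<tau>" "\<lambda>p. p \<circ> ?\<tau>"])
      fix p assume "p \<in> ?P"
      then show "p \<circ> ?\<tau> \<in> ?P" using permutes_compose[OF \<tau>] by simp
      then show "p \<circ> ?\<tau> \<in> ?P" .
    qed (simp_all add: comp_assoc)
    also have "\<dots> = sum (?h i) ?P"
    proof (intro sum.cong refl)
      fix p :: "nat \<Rightarrow> nat"
      have "f (p \<circ> ?\<tau>) = f p"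
        using i j by (intro f) (simp add: Transposition.transpose_def)
      then show "?h j (p \<circ> ?\<tau>) = ?h i p" by simp
    qed
    finally show ?thesis ..
  qed
  have le1: "(\<Sum>i=t..<n. ?h i p) \<le> 1" if "p \<in> ?P" for p
  proof -
    have "inj p" using that permutes_inj by auto
    have "(\<Sum>i=t..<n. ?h i p) = real (card {i \<in> {t..<n}. g (f p) = Some (p i)})"
      by (simp add: of_bool_def sum.If_cases Int_def)
    also have "card {i \<in> {t..<n}. g (f p) = Some (p i)} \<le> 1"
      by (simp add: card_le_Suc0_iff_eq) (metis \<open>inj p\<close> inj_eq option.inject)
    finally show ?thesis by simp
  qed
  have "real (n - t) * sum (?h j) ?P = (\<Sum>i=t..<n. sum (?h i) ?P)"
    using sym by simp
  also have "\<dots> = (\<Sum>p\<in>?P. \<Sum>i=t..<n. ?h i p)" by (rule sum.swap)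
  also have "\<dots> \<le> (\<Sum>p\<in>?P. 1)" by (intro sum_mono le1)
  also have "\<dots> = fact n" using card_permutations[of "{..<n}" n] by simp
  finally show ?thesis using j by (simp add: field_simps)
qed

section \<open>Estimates for harmonic sums\<close>

text \<open>The term for \<open>t\<close> occurs \<open>m - t\<close> times, and
  \<open>(m - t) / (n - t) = 1 - (n - m) / (n - t)\<close>.\<close>

lemma sum_triangle_harmonic:
  assumes "m \<le> n"
  shows "(\<Sum>j<m. \<Sum>t\<le>j. 1 / real (n - t)) = m - real (n - m) * (\<Sum>t<m. 1 / real (n - t))"
  using assms
proof (induction m)
  case (Suc m)
  define d where "d = real (n - m)"
  define H where "H = (\<Sum>t<m. 1 / real (n - t))"
  have d: "d > 0" "real (n - Suc m) = d - 1" using Suc.prems by (auto simp: d_def)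
  have "(\<Sum>j<Suc m. \<Sum>t\<le>j. 1 / real (n - t)) = (m - d * H) + (H + 1 / d)"
    using Suc by (simp add: d_def H_def flip: lessThan_Suc_atMost)
  also have "\<dots> = Suc m - (d - 1) * (H + 1 / d)"
    using d by (simp add: field_simps)
  finally show ?case unfolding d by (simp add: d_def H_def)
qed simp

text \<open>The logarithm telescopes into terms \<open>ln (1 + 1 / d)\<close>, each at most
  \<open>1 / d\<close>.\<close>

lemma harmonic_diff_ge_ln:
  assumes "m \<le> n"
  shows "ln ((real n + 1) / (real (n - m) + 1)) \<le> (\<Sum>t<m. 1 / real (n - t))"
  using assms
proof (induction m)
  case (Suc m)
  define d where "d = real (n - m)"
  have d: "d > 0" "real (n - Suc m) = d - 1" using Suc.prems by (auto simp: d_def)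
  have "(real n + 1) / d = (real n + 1) / (d + 1) * (1 + 1 / d)"
    using d by (simp add: add_divide_distrib[symmetric] add_divide_eq_iff)
  then have "ln ((real n + 1) / d) = ln ((real n + 1) / (d + 1)) + ln (1 + 1 / d)"
    using d by (simp only:, subst ln_mult_pos) (auto simp: add_pos_pos)
  moreover have "ln (1 + 1 / d) \<le> 1 / d" using d by (intro ln_add_one_self_le_self) auto
  ultimately show ?case using Suc d by (simp add: d_def)
qed simp

section \<open>Total gain of a deterministic algorithm over all orders\<close>

lemma sum_permutations_gain_le:
  assumes n: "n > 0" and m: "m \<le> n"
    and feas: "\<And>p. p permutes {..<n} \<Longrightarrow>
      feasible (deletion_input n p) (run a (deletion_input n p))"
  shows "(\<Sum>p | p permutes {..<n}. gain (deletion_input n p) (run a (deletion_input n p)))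
    \<le> fact n * (real n - real (n - m) * ln ((real n + 1) / (real (n - m) + 1)))"
proof -
  let ?P = "{p. p permutes {..<n}}"
  let ?s = "\<lambda>p. run a (deletion_input n p)"
  let ?c = "\<lambda>p j. \<Sum>t\<le>j. of_bool (?s p ! t = Some (p j)) :: real"
  have len: "length (deletion_input n p) = n" for p using n by (rule length_deletion_input)
  have card: "real (card ?P) = fact n"
    using card_permutations[of "{..<n}" n] by simp
  have early: "(\<Sum>p\<in>?P. ?c p j) \<le> fact n * (\<Sum>t\<le>j. 1 / real (n - t))" if "j < n" for j
  proof -
    have "(\<Sum>p\<in>?P. ?c p j) = (\<Sum>t\<le>j. \<Sum>p\<in>?P. of_bool (?s p ! t = Some (p j)))"
      by (rule sum.swap)
    also have "\<dots> = (\<Sum>t\<le>j. \<Sum>p\<in>?P. of_bool (a (history (deletion_input n p) t) = Some (p j)))"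
      using that by (intro sum.cong refl) (simp add: run_def len)
    also have "\<dots> \<le> (\<Sum>t\<le>j. fact n / real (n - t))"
      using that
      by (intro sum_mono sum_permutations_hit_le history_deletion_input_cong) auto
    finally show ?thesis by (simp add: sum_distrib_left)
  qed
  have late: "(\<Sum>p\<in>?P. ?c p j) \<le> fact n" if "j < n" for j
  proof -
    have "(\<Sum>p\<in>?P. ?c p j) \<le> (\<Sum>p\<in>?P. 1)"
      using that by (intro sum_mono sum_collected_le_1[OF feas]) (auto simp: len)
    then show ?thesis using card by simp
  qed
  have "(\<Sum>p\<in>?P. gain (deletion_input n p) (?s p)) = (\<Sum>p\<in>?P. \<Sum>j<n. ?c p j)"
    using n feas by (intro sum.cong refl gain_deletion_input) auto
  also have "\<dots> = (\<Sum>j<n. \<Sum>p\<in>?P. ?c p j)" by (rule sum.swap)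
  \<comment> \<open>The symmetry bound grows with \<open>j\<close>, so from the cut \<open>m\<close>
    on it is replaced by the trivial bound of one collection per item.\<close>
  also have "\<dots> = (\<Sum>j<m. \<Sum>p\<in>?P. ?c p j) + (\<Sum>j=m..<n. \<Sum>p\<in>?P. ?c p j)"
    using m by (subst sum.union_disjoint[symmetric]) (auto intro: sum.cong)
  also have "\<dots> \<le> (\<Sum>j<m. fact n * (\<Sum>t\<le>j. 1 / real (n - t))) + (\<Sum>j=m..<n. fact n)"
    using m by (intro add_mono sum_mono early late) auto
  also have "\<dots> = fact n * ((\<Sum>j<m. \<Sum>t\<le>j. 1 / real (n - t)) + real (n - m))"
    by (simp add: sum_distrib_left distrib_left mult.commute)
  also have "\<dots> = fact n * (real n - real (n - m) * (\<Sum>t<m. 1 / real (n - t)))"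
    unfolding sum_triangle_harmonic[OF m] using m by (simp add: of_nat_diff)
  also have "\<dots> \<le> fact n * (real n - real (n - m) * ln ((real n + 1) / (real (n - m) + 1)))"
    using m by (intro mult_left_mono diff_left_mono harmonic_diff_ge_ln) auto
  finally show ?thesis .
qed

lemma sum_permutations_gain_le_exp:
  assumes n: "n \<ge> 3"
    and feas: "\<And>p. p permutes {..<n} \<Longrightarrow>
      feasible (deletion_input n p) (run a (deletion_input n p))"
  shows "(\<Sum>p | p permutes {..<n}. gain (deletion_input n p) (run a (deletion_input n p)))
    \<le> fact n * (real n * (1 - 1 / exp 1) + 2)"
proof -
  define x where "x = (real n + 1) / exp 1"
  have "exp 1 \<le> (3::real)" by (rule exp_le)
  with n have "exp 1 \<le> real n + 1" by linarith
  then have x: "1 \<le> x" "x \<le> real n + 1"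
    using mult_left_mono[of 1 "exp 1" "real n + 1"] by (simp_all add: x_def divide_le_eq)
  \<comment> \<open>Rounded so that \<open>k + 1 \<le> (n + 1) / e\<close>, which makes the logarithm at least \<open>1\<close>.\<close>
  define k where "k = nat \<lfloor>x\<rfloor> - 1"
  have "nat \<lfloor>x\<rfloor> \<ge> 1" using x by linarith
  then have k: "real k + 1 = of_int \<lfloor>x\<rfloor>" using x by (simp add: k_def of_nat_diff)
  \<comment> \<open>Rounding down and subtracting one cost less than 2 in total, which is the
    additive constant of the claim.\<close>
  have kx: "real k + 1 \<le> x" "x - 2 \<le> real k" using k by linarith+
  have "k \<le> n" using kx x by linarith
  have "exp 1 \<le> (real n + 1) / (real k + 1)"
    using kx by (simp add: x_def field_simps)
  then have "1 \<le> ln ((real n + 1) / (real k + 1))" by (subst ln_ge_iff) auto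
  then have "real k \<le> real k * ln ((real n + 1) / (real k + 1))"
    using mult_left_mono[of 1 _ "real k"] by simp
  moreover have "real n / exp 1 \<le> x" by (simp add: x_def field_simps)
  ultimately have "real n - real k * ln ((real n + 1) / (real k + 1))
      \<le> real n * (1 - 1 / exp 1) + 2"
    using kx by (simp add: algebra_simps)
  then have "fact n * (real n - real k * ln ((real n + 1) / (real k + 1)))
      \<le> fact n * (real n * (1 - 1 / exp 1) + 2)"
    by (intro mult_left_mono) auto
  moreover have "(\<Sum>p | p permutes {..<n}. gain (deletion_input n p) (run a (deletion_input n p)))
      \<le> fact n * (real n - real k * ln ((real n + 1) / (real k + 1)))"
    using sum_permutations_gain_le[of n "n - k" a] n \<open>k \<le> n\<close> feas by simp
  ultimately show ?thesis by linarith
qed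

section \<open>Randomized algorithms\<close>

text \<open>For a fixed input the gain is a finite sum of measurable functions, each taking finitely
  many values.\<close>

lemma integrable_gain_run:
  assumes "randomized_online_algorithm C M A"
  shows "integrable M (\<lambda>\<omega>. gain I (run (A \<omega>) I))"
proof -
  interpret prob_space M
    using assms by (simp add: randomized_online_algorithm_def)
  define w where "w t c = (case c of None \<Rightarrow> 0 | Some x \<Rightarrow> the (active_at I t x))" for t c
  have "integrable M (\<lambda>\<omega>. w t (A \<omega> (history I t)))" for t
  proof (rule integrable_const_bound)
    \<comment> \<open>The value \<open>the None\<close> accounts for choices of inactive items, as
      \<open>I\<close> is arbitrary and the run may be infeasible.\<close>
    have "range (w t) \<subseteq> insert 0 (insert (the None) (ran (active_at I t)))"
    proof (rule image_subsetI)
      fix c show "w t c \<in> insert 0 (insert (the None) (ran (active_at I t)))"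
      proof (cases c)
        case (Some x)
        then show ?thesis by (cases "active_at I t x") (auto simp: w_def intro: ranI)
      qed (simp add: w_def)
    qed
    moreover have "finite (ran (active_at I t))"
      by (simp add: active_at_def finite_dom_contents finite_ran)
    ultimately have "finite (range (w t))" by (simp add: finite_subset)
    then have "\<bar>w t c\<bar> \<le> Max (abs ` range (w t))" for c by (intro Max_ge) auto
    then show "AE \<omega> in M. norm (w t (A \<omega> (history I t))) \<le> Max (abs ` range (w t))"
      by (intro AE_I2) simp
    have "(\<lambda>\<omega>. A \<omega> (history I t)) \<in> measurable M (count_space UNIV)"
      using assms by (simp add: randomized_online_algorithm_def)
    then show "(\<lambda>\<omega>. w t (A \<omega> (history I t))) \<in> borel_measurable M"
      by (rule measurable_compose) simp
  qed
  then have "integrable M (\<lambda>\<omega>. \<Sum>t<length I. w t (A \<omega> (history I t)))" by auto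
  then show ?thesis by (simp add: gain_def run_def w_def)
qed

text \<open>The averaging direction of Yao's principle: competitiveness on each input is summed over
  all orders, sum and expectation are exchanged, and the deterministic bound applies for each fixed
  \<omega>.\<close>

lemma competitive_imp_le:
  assumes alg: "randomized_online_algorithm uniform_decremental_inputs M A"
    and comp: "competitive uniform_decremental_inputs M A R"
    and n: "n \<ge> 3"
  shows "real n / R \<le> real n * (1 - 1 / exp 1) + 2"
proof -
  interpret prob_space M
    using alg by (simp add: randomized_online_algorithm_def)
  let ?P = "{p. p permutes {..<n}}"
  let ?G = "\<lambda>p \<omega>. gain (deletion_input n p) (run (A \<omega>) (deletion_input n p))"
  have R: "R > 0" using comp by (simp add: competitive_def)
  have int: "integrable M (?G p)" for p by (rule integrable_gain_run[OF alg])
  have "real n / R \<le> expectation (?G p)" if "p \<in> ?P" for p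
  proof -
    have "real n / R \<le> OPT (deletion_input n p) / R"
      using that n R by (intro divide_right_mono OPT_deletion_input_ge) auto
    also have "\<dots> \<le> expectation (?G p)"
      using that comp deletion_input_uniform_decremental
      by (auto simp: competitive_def expected_gain_def)
    finally show ?thesis .
  qed
  then have "(\<Sum>p\<in>?P. real n / R) \<le> (\<Sum>p\<in>?P. expectation (?G p))"
    by (rule sum_mono)
  also have "\<dots> = expectation (\<lambda>\<omega>. \<Sum>p\<in>?P. ?G p \<omega>)"
    using int by (simp add: Bochner_Integration.integral_sum)
  also have "\<dots> \<le> fact n * (real n * (1 - 1 / exp 1) + 2)"
  proof (rule integral_le_const)
    show "integrable M (\<lambda>\<omega>. \<Sum>p\<in>?P. ?G p \<omega>)" using int by simp
    show "AE \<omega> in M. (\<Sum>p\<in>?P. ?G p \<omega>) \<le> fact n * (real n * (1 - 1 / exp 1) + 2)"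
      using alg n deletion_input_uniform_decremental
      by (intro AE_I2 sum_permutations_gain_le_exp) (auto simp: randomized_online_algorithm_def)
  qed
  also have "(\<Sum>p\<in>?P. real n / R) = fact n * (real n / R)"
    using card_permutations[of "{..<n}" n] by simp
  finally show ?thesis by (rule mult_left_le_imp_le) simp
qed

theorem theorem1:
  fixes M :: "'w measure" and A :: "'w \<Rightarrow> online_algorithm"
  assumes "randomized_online_algorithm uniform_decremental_inputs M A"
  shows "ereal (exp 1 / (exp 1 - 1)) \<le> competitive_ratio uniform_decremental_inputs M A"
  unfolding competitive_ratio_def
proof (rule Inf_greatest)
  fix r assume "r \<in> ereal ` {R. competitive uniform_decremental_inputs M A R}"
  then obtain R where R: "r = ereal R" "competitive uniform_decremental_inputs M A R" by auto
  have pos: "R > 0" using R by (simp add: competitive_def)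
  have e: "exp 1 > (1::real)" by simp
  have "1 / R \<le> 1 - 1 / exp 1"
  proof (rule ccontr)
    \<comment> \<open>The additive 2 is removed by letting \<open>n\<close> grow: a gap \<delta> > 0
      would force \<open>n * \<delta> \<le> 2\<close> for every \<open>n \<ge> 3\<close>.\<close>
    define \<delta> where "\<delta> = 1 / R - (1 - 1 / exp 1)"
    assume "\<not> ?thesis"
    then have "\<delta> > 0" by (simp add: \<delta>_def)
    obtain N :: nat where N: "2 / \<delta> < real N" using reals_Archimedean2 by blast
    let ?n = "N + 3"
    have "2 < real ?n * \<delta>" using N \<open>\<delta> > 0\<close> by (simp add: field_simps)
    moreover have "real ?n * \<delta> \<le> 2"
      using competitive_imp_le[OF assms R(2), of ?n] by (simp add: \<delta>_def right_diff_distrib)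
    ultimately show False by linarith
  qed
  then have "exp 1 / (exp 1 - 1) \<le> R" using pos e by (simp add: field_simps)
  then show "ereal (exp 1 / (exp 1 - 1)) \<le> r" using R by simp
qed

end
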